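(* Let $\sigma>0$, $\alpha>0$, $0\leqslant\rho\leqslant1$, $\boldsymbol{\theta}=(\sigma,\alpha,\rho)^\top$, let $W\sim{\rm UF}(\boldsymbol{\theta})$, and let $Y$ be a positive random variable with CDF $$G(x;\rho)=\frac{x}{x+1}\cdot\frac{(x+1)^2-\rho}{(x+1)^2-\rho x},\qquad x>0.$$ Then for every $0<p<1$ the $p$-quantiles $Q_W(p)$ of $W$ and $Q_Y(p)$ of $Y$ satisfy $$Q_W(p)=\frac{\sigma\,Q_Y(p)^{1/\alpha}}{1+\sigma\,Q_Y(p)^{1/\alpha}},$$ and $Q_Y(p)$ is the only zero in $(0,\infty)$ of the cubic polynomial $$(p-1)x^3+[(3-\rho)p-2]x^2+[(3-\rho)p+\rho-1]x+p.$$
   Context: For $\boldsymbol{\theta}=(\sigma,\alpha,\rho)^\top$ with $\sigma>0$, $\alpha>0$, $0\leqslant\rho\leqslant1$, the unit-Fréchet distribution ${\rm UF}(\boldsymbol{\theta})$ is the distribution on $(0,1)$ with CDF, for $0<w<1$, $$F_W(w;\boldsymbol{\theta})=\frac{\frac{s^\alpha}{\sigma^\alpha}}{\frac{s^\alpha}{\sigma^\alpha}+1}\cdot\frac{\left(\frac{s^\alpha}{\sigma^\alpha}+1\right)^2-\rho}{\left(\frac{s^\alpha}{\sigma^\alpha}+1\right)^2-\rho\,\frac{s^\alpha}{\sigma^\alpha}},\qquad s=\frac{w}{1-w}.$$ The $p$-quantile of a random variable $Z$ with CDF $F_Z$ is $Q_Z(p)=\inf\{z: F_Z(z)\geqslant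 p\}$. *)

theory Defs
  imports "HOL-Probability.Probability"
begin

text \<open>
  On the reals the infimum is only meaningful for nonempty sets bounded below; for the
  distribution of a real random variable this is the case whenever \<open>0 < p < 1\<close>.
\<close>
definition quantile :: "'a measure \<Rightarrow> ('a \<Rightarrow> real) \<Rightarrow> real \<Rightarrow> real" where
  "quantile M Z p = Inf {z. cdf (distr M borel Z) z \<ge> p}"

definition uf_cdf :: "real \<Rightarrow> real \<Rightarrow> real \<Rightarrow> real \<Rightarrow> real" where
  "uf_cdf \<sigma> \<alpha> \<rho> w =
     (let s = w / (1 - w);
          t = s powr \<alpha> / \<sigma> powr \<alpha>
      in t / (t + 1) * (((t + 1)\<^sup>2 - \<rho>) / ((t + 1)\<^sup>2 - \<rho> * t)))"

definition G_cdf :: "real \<Rightarrow> real \<Rightarrow> real" where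
  "G_cdf \<rho> x = x / (x + 1) * (((x + 1)\<^sup>2 - \<rho>) / ((x + 1)\<^sup>2 - \<rho> * x))"

text \<open>
  The formula for the distribution function is only imposed on the open interval that
  carries the distribution. The support conditions are almost sure, as they concern
  the distribution and not the individual random variable.
\<close>
definition unit_frechet :: "'a measure \<Rightarrow> ('a \<Rightarrow> real) \<Rightarrow> real \<Rightarrow> real \<Rightarrow> real \<Rightarrow> bool" where
  "unit_frechet M W \<sigma> \<alpha> \<rho> \<longleftrightarrow>
     prob_space M \<and> W \<in> borel_measurable M \<and> (AE \<omega> in M. 0 < W \<omega> \<and> W \<omega> < 1) \<and>
     (\<forall>w. 0 < w \<and> w < 1 \<longrightarrow> cdf (distr M borel W) w = uf_cdf \<sigma> \<alpha> \<rho> w)"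

end

theory Submission
  imports Defs
begin

text \<open>
  Clearing denominators, \<open>G_cdf \<rho> x \<ge> p\<close> becomes \<open>poly (uf_cubic \<rho> p) x \<le> 0\<close>.
  The coefficients of \<open>x\<close> and \<open>x\<^sup>2\<close> satisfy \<open>c\<^sub>1 > c\<^sub>2\<close>, so its coefficients change sign
  exactly once, and by Descartes' argument the cubic goes from positive to negative at its
  only positive zero \<open>r\<close>.  Hence the superlevel set of the distribution function of \<open>Y\<close> is
  \<open>{r..}\<close>.  The distribution function of \<open>W\<close> is \<open>G_cdf \<rho>\<close> after the increasing substitution
  \<open>t = (s / \<sigma>) powr \<alpha>\<close>, \<open>s = w / (1 - w)\<close>, which carries \<open>r\<close> back to the quantile of \<open>W\<close>.
\<close>

definition uf_cubic :: "real \<Rightarrow> real \<Rightarrow> real poly" where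
  "uf_cubic \<rho> p = [:p, (3 - \<rho>) * p + \<rho> - 1, (3 - \<rho>) * p - 2, p - 1:]"

lemma G_cdf_ge_iff:
  assumes "0 \<le> \<rho>" "\<rho> \<le> 1" "0 < x"
  shows "p \<le> G_cdf \<rho> x \<longleftrightarrow> poly (uf_cubic \<rho> p) x \<le> 0"
proof -
  \<comment> \<open>These two bounds make the denominator of \<open>G_cdf\<close> positive, so
    clearing it preserves the direction of the inequality.\<close>
  have "\<rho> * x \<le> x"
    using assms by (simp add: mult_left_le_one_le)
  moreover have "x < (x + 1)\<^sup>2"
    using assms(3) by (simp add: power2_eq_square algebra_simps add_pos_pos)
  ultimately have D: "0 < (x + 1) * ((x + 1)\<^sup>2 - \<rho> * x)"
    using assms(3) by (intro mult_pos_pos) linarith+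
  have "p \<le> G_cdf \<rho> x \<longleftrightarrow> p \<le> (x * ((x + 1)\<^sup>2 - \<rho>)) / ((x + 1) * ((x + 1)\<^sup>2 - \<rho> * x))"
    by (simp add: G_cdf_def)
  also have "\<dots> \<longleftrightarrow> p * ((x + 1) * ((x + 1)\<^sup>2 - \<rho> * x)) - x * ((x + 1)\<^sup>2 - \<rho>) \<le> 0"
    using D by (simp add: pos_le_divide_eq)
  also have "p * ((x + 1) * ((x + 1)\<^sup>2 - \<rho> * x)) - x * ((x + 1)\<^sup>2 - \<rho>) = poly (uf_cubic \<rho> p) x"
    by (simp add: uf_cubic_def power2_eq_square algebra_simps)
  finally show ?thesis .
qed

text \<open>The condition \<open>bc\<close> excludes \<open>b < 0 < c\<close>, the only pattern with
  three sign changes. Otherwise dividing by a suitable power of the variable gives a strictly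
  decreasing function on the positive axis.\<close>

lemma cubic_single_sign_change:
  fixes a b c d x y :: real
  assumes "0 < a" "0 < d" and bc: "0 < b \<or> c < 0" and "0 < x" "x < y"
    and "poly [:a, b, c, -d:] x \<le> 0"
  shows "poly [:a, b, c, -d:] y < 0"
proof -
  have y: "0 < y" using assms by simp
  show ?thesis
  proof (cases "c < 0")
    case True
    \<comment> \<open>Compare the cubic divided by \<open>x\<close>, which is strictly decreasing.\<close>
    have "poly [:a, b, c, -d:] y * x - poly [:a, b, c, -d:] x * y
        = (x - y) * (a + x * y * (d * (x + y) - c))"
      by (simp add: algebra_simps)
    also have "\<dots> < 0"
      using assms True y by (intro mult_neg_pos add_pos_pos mult_pos_pos)
        (auto simp: less_diff_eq intro: less_trans[OF _ mult_pos_pos] add_pos_pos)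
    finally have "poly [:a, b, c, -d:] y * x < poly [:a, b, c, -d:] x * y" by simp
    also have "\<dots> \<le> 0" using assms(6) y by (simp only: mult_nonpos_nonneg less_imp_le)
    finally show ?thesis using \<open>0 < x\<close> by (simp only: mult_less_0_iff) auto
  next
    case False
    \<comment> \<open>Compare the cubic divided by \<open>x ^ 3\<close>, which is strictly decreasing.\<close>
    then have b: "0 < b" and c: "0 \<le> c" using bc by auto
    have "poly [:a, b, c, -d:] y * x ^ 3 - poly [:a, b, c, -d:] x * y ^ 3
        = (x - y) * (a * (x\<^sup>2 + x * y + y\<^sup>2) + (b * (x + y) * (x * y) + c * (x * y)\<^sup>2))"
      by (simp add: algebra_simps power2_eq_square power3_eq_cube)
    also have "\<dots> < 0"
      using assms b c y by (intro mult_neg_pos add_pos_pos add_pos_nonneg mult_pos_pos) auto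
    finally have "poly [:a, b, c, -d:] y * x ^ 3 < poly [:a, b, c, -d:] x * y ^ 3" by simp
    also have "\<dots> \<le> 0"
      using assms(6) y by (simp only: mult_nonpos_nonneg less_imp_le zero_less_power)
    finally show ?thesis using \<open>0 < x\<close> by (simp only: mult_less_0_iff zero_less_power) auto
  qed
qed

lemma uf_cubic_unique_zero:
  assumes "0 \<le> \<rho>" "0 < p" "p < 1"
  obtains r where "0 < r" "{x \<in> {0<..}. poly (uf_cubic \<rho> p) x = 0} = {r}"
    "\<And>x. 0 < x \<Longrightarrow> poly (uf_cubic \<rho> p) x \<le> 0 \<longleftrightarrow> r \<le> x"
proof -
  have neg: "poly (uf_cubic \<rho> p) y < 0" if "0 < x" "x < y" "poly (uf_cubic \<rho> p) x \<le> 0" for x y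
  proof -
    \<comment> \<open>The two coefficients differ by \<open>\<rho> + 1\<close>, which is positive,
      so the first cannot be nonpositive while the second is nonnegative.\<close>
    have "0 < (3 - \<rho>) * p + \<rho> - 1 \<or> (3 - \<rho>) * p - 2 < 0"
      using assms(1) by linarith
    with cubic_single_sign_change[of p "1 - p" _ _ x y] that assms show ?thesis
      unfolding uf_cubic_def by simp
  qed
  have "0 < lead_coeff (- uf_cubic \<rho> p)" using assms by (simp add: uf_cubic_def)
  then obtain n where n: "\<forall>x\<ge>n. lead_coeff (- uf_cubic \<rho> p) \<le> poly (- uf_cubic \<rho> p) x"
    using poly_pinfty_gt_lc by blast
  \<comment> \<open>The maximum with 1 keeps the right endpoint for the intermediate value theorem
    above 0, even if \<open>n\<close> is negative.\<close>
  have "poly (uf_cubic \<rho> p) (max n 1) < 0"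
    using n[rule_format, of "max n 1"] \<open>0 < lead_coeff (- uf_cubic \<rho> p)\<close> by simp
  moreover have "0 < poly (uf_cubic \<rho> p) 0" using assms by (simp add: uf_cubic_def)
  ultimately obtain r where r: "0 < r" "poly (uf_cubic \<rho> p) r = 0"
    using poly_IVT_neg[of 0 "max n 1" "uf_cubic \<rho> p"] by (auto simp: less_max_iff_disj)
  \<comment> \<open>Left of \<open>r\<close>, a nonpositive value would by \<open>neg\<close> force
    a negative value at the zero \<open>r\<close>; right of \<open>r\<close>, \<open>neg\<close>
    applies starting from \<open>r\<close>.\<close>
  have iff: "poly (uf_cubic \<rho> p) x \<le> 0 \<longleftrightarrow> r \<le> x" if "0 < x" for x
    using neg[OF that, of r] neg[OF r(1), of x] r
    by (cases x r rule: linorder_cases) auto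
  have "{x \<in> {0<..}. poly (uf_cubic \<rho> p) x = 0} = {r}"
    using neg[OF r(1)] r iff by (force simp: order.order_iff_strict)
  with r iff that show thesis by blast
qed

lemma (in prob_space) cdf_distr:
  assumes "X \<in> borel_measurable M"
  shows "cdf (distr M borel X) x = prob {\<omega> \<in> space M. X \<omega> \<le> x}"
  using assms by (auto simp: cdf_def measure_distr intro!: arg_cong[where f = prob])

text \<open>Both substitutions are increasing: \<open>c\<close> is the value of \<open>s\<close> at
  which \<open>(s / \<sigma>) powr \<alpha>\<close> equals \<open>r\<close>, and
  \<open>c / (1 + c)\<close> solves \<open>w / (1 - w) = c\<close>.\<close>

lemma uf_substitution_ge_iff:
  fixes \<sigma> \<alpha> r w :: real
  assumes "0 < \<sigma>" "0 < \<alpha>" "0 < r" "0 < w" "w < 1"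
  defines "c \<equiv> \<sigma> * r powr (1 / \<alpha>)"
  shows "r \<le> (w / (1 - w)) powr \<alpha> / \<sigma> powr \<alpha> \<longleftrightarrow> c / (1 + c) \<le> w"
proof -
  have c: "0 < c" using assms by (simp add: c_def)
  have s: "0 < w / (1 - w)" using assms by simp
  have "r \<le> (w / (1 - w)) powr \<alpha> / \<sigma> powr \<alpha> \<longleftrightarrow> c powr \<alpha> \<le> (w / (1 - w)) powr \<alpha>"
    using assms by (simp add: c_def powr_mult powr_powr field_simps)
  also have "\<dots> \<longleftrightarrow> c \<le> w / (1 - w)"
    using c s \<open>0 < \<alpha>\<close> powr_mono2[of \<alpha> c "w / (1 - w)"] powr_less_mono2[of \<alpha> "w / (1 - w)" c]
    by linarith
  also have "\<dots> \<longleftrightarrow> c / (1 + c) \<le> w"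
    using c assms(4,5) by (simp add: field_simps)
  finally show ?thesis .
qed

theorem mainTheorem6:
  fixes \<sigma> \<alpha> \<rho> p :: real
    and M :: "'a measure" and W :: "'a \<Rightarrow> real"
    and N :: "'b measure" and Y :: "'b \<Rightarrow> real"
  assumes "\<sigma> > 0" and "\<alpha> > 0" and "0 \<le> \<rho>" and "\<rho> \<le> 1"
    and "unit_frechet M W \<sigma> \<alpha> \<rho>"
    and "prob_space N" and "Y \<in> borel_measurable N"
    and "AE \<omega> in N. 0 < Y \<omega>"
    and "\<And>x. x > 0 \<Longrightarrow> cdf (distr N borel Y) x = G_cdf \<rho> x"
    and "0 < p" and "p < 1"
  shows "quantile M W p =
           \<sigma> * quantile N Y p powr (1 / \<alpha>) / (1 + \<sigma> * quantile N Y p powr (1 / \<alpha>)) \<and>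
         {x \<in> {0<..}. poly [:p, (3 - \<rho>) * p + \<rho> - 1, (3 - \<rho>) * p - 2, p - 1:] x = 0}
           = {quantile N Y p}"
proof -
  obtain r where r: "0 < r" "{x \<in> {0<..}. poly (uf_cubic \<rho> p) x = 0} = {r}"
    and r_iff: "\<And>x. 0 < x \<Longrightarrow> poly (uf_cubic \<rho> p) x \<le> 0 \<longleftrightarrow> r \<le> x"
    using uf_cubic_unique_zero[OF assms(3,10,11)] by blast
  have G_iff: "p \<le> G_cdf \<rho> x \<longleftrightarrow> r \<le> x" if "0 < x" for x
    using G_cdf_ge_iff[OF assms(3,4) that] r_iff[OF that] by simp
  have "{z. p \<le> cdf (distr N borel Y) z} = {r..}"
  proof (intro set_eqI, simp)
    fix z
    show "p \<le> cdf (distr N borel Y) z \<longleftrightarrow> r \<le> z"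
    proof (cases "0 < z")
      case True
      then show ?thesis using assms(9) G_iff by simp
    next
      case False
      interpret N: prob_space N by fact
      \<comment> \<open>The formula \<open>G_cdf\<close> is assumed only at positive arguments; here
        the almost sure positivity of \<open>Y\<close> settles the value.\<close>
      have "AE \<omega> in N. \<not> Y \<omega> \<le> z" using assms(8) by eventually_elim (use False in auto)
      then have "cdf (distr N borel Y) z = 0"
        using assms(7) by (simp add: N.cdf_distr N.prob_Collect_eq_0)
      then show ?thesis using False r(1) \<open>0 < p\<close> by simp
    qed
  qed
  then have QY: "quantile N Y p = r" by (simp add: quantile_def)

  define c where "c = \<sigma> * r powr (1 / \<alpha>)"
  have c: "0 < c" using assms(1) r(1) by (simp add: c_def)
  have W: "prob_space M" "W \<in> borel_measurable M" "AE \<omega> in M. 0 < W \<omega> \<and> W \<omega> < 1"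
    and W_cdf: "\<And>w. 0 < w \<Longrightarrow> w < 1 \<Longrightarrow> cdf (distr M borel W) w = uf_cdf \<sigma> \<alpha> \<rho> w"
    using assms(5) unfolding unit_frechet_def by auto
  interpret M: prob_space M by fact
  have "{w. p \<le> cdf (distr M borel W) w} = {c / (1 + c)..}"
  proof (intro set_eqI, simp)
    fix w :: real
    consider "w \<le> 0" | "0 < w" "w < 1" | "1 \<le> w" by linarith
    then show "p \<le> cdf (distr M borel W) w \<longleftrightarrow> c / (1 + c) \<le> w"
    proof cases
      case 1
      have "AE \<omega> in M. \<not> W \<omega> \<le> w" using W(3) by eventually_elim (use 1 in auto)
      then have "cdf (distr M borel W) w = 0"
        using W(2) by (simp add: M.cdf_distr M.prob_Collect_eq_0)
      moreover have "0 < c / (1 + c)" using c by simp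
      ultimately show ?thesis using 1 \<open>0 < p\<close> by linarith
    next
      case 2
      have "uf_cdf \<sigma> \<alpha> \<rho> w = G_cdf \<rho> ((w / (1 - w)) powr \<alpha> / \<sigma> powr \<alpha>)"
        by (simp add: uf_cdf_def G_cdf_def Let_def)
      moreover have "0 < (w / (1 - w)) powr \<alpha> / \<sigma> powr \<alpha>" using 2 assms(1) by simp
      ultimately show ?thesis
        using 2 W_cdf G_iff uf_substitution_ge_iff[OF assms(1,2) r(1) 2] by (simp add: c_def)
    next
      case 3
      \<comment> \<open>From 1 on, the support condition replaces the formula, and both sides of the
        equivalence are true.\<close>
      have "AE \<omega> in M. W \<omega> \<le> w" using W(3) by eventually_elim (use 3 in auto)
      then have "cdf (distr M borel W) w = 1"
        using W(2) by (simp add: M.cdf_distr M.prob_Collect_eq_1)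
      moreover have "c / (1 + c) < 1" using c by simp
      ultimately show ?thesis using 3 \<open>p < 1\<close> by linarith
    qed
  qed
  then have "quantile M W p = c / (1 + c)" by (simp add: quantile_def)
  with QY r(2) show ?thesis by (simp add: c_def uf_cubic_def)
qed

end
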